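(* Let $S_{\rm lcm}(n)$ denote the set of permutations $\pi$ of $[n]=\{1,\dots,n\}$ such that $\operatorname{lcm}[j,\pi(j)]\le n$ for every $j\in[n]$. For any positive integer $b$, \[ \#S_{\rm lcm}(n)\ge \exp\big((c(b)\alpha(b)+o(1))\,n\big)\quad\text{as } n\to\infty, \] where $c(b)$ and $\alpha(b)$ are defined below.
   Context: For a positive integer $b$ and a divisor $a\mid b$, let $s(a,b)=\{d\mid b: d\le a\}$, and let $p(a,b)$ be the number of permutations $\sigma$ of $s(a,b)$ such that $\operatorname{lcm}[d,\sigma(d)]\le a$ for every $d\in s(a,b)$. Let $\tau(b)$ be the number of positive divisors of $b$, and write the divisors of $b$ in increasing order as $1=a_1<a_2<\dots<a_{\tau(b)}=b$. Define \[ c(b)=\frac{\log(\tau(b)!)}{b}+\sum_{i=1}^{\tau(b)-1}\Big(\frac1{a_i}-\frac1{a_{i+1}}\Big)\log p(a_i,b). \] Let $\alpha$ be the multiplicative function on positive integers defined on prime powers by $\alpha(p^i)=\dfrac{p^{i+1}-p^i}{p^{i+1}-1}$ (so $\alpha(1)=1$). *)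

theory Defs
  imports
    Complex_Main
    "HOL-Combinatorics.Permutations"
    "HOL-Computational_Algebra.Primes"
    "HOL-Library.Landau_Symbols"
begin

(* The predicate permutes makes \<pi> the identity outside the given set, so the permutations
   of a finite set correspond one-to-one to the functions counted here. *)
definition S_lcm :: "nat \<Rightarrow> (nat \<Rightarrow> nat) set" where
  "S_lcm n = {\<pi>. \<pi> permutes {1..n} \<and> (\<forall>j\<in>{1..n}. lcm j (\<pi> j) \<le> n)}"

definition small_divisors :: "nat \<Rightarrow> nat \<Rightarrow> nat set" where
  "small_divisors a b = {d. d dvd b \<and> d \<le> a}"

definition num_perms :: "nat \<Rightarrow> nat \<Rightarrow> nat" where
  "num_perms a b =
     card {\<sigma>. \<sigma> permutes small_divisors a b \<and>
              (\<forall>d\<in>small_divisors a b. lcm d (\<sigma> d) \<le> a)}"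

definition divisor_count :: "nat \<Rightarrow> nat" where
  "divisor_count b = card {d. d dvd b}"

(* 1-based: divisor_nth b 1 = 1 and divisor_nth b (divisor_count b) = b for b > 0;
   not meaningful for indices outside {1..divisor_count b}. *)
definition divisor_nth :: "nat \<Rightarrow> nat \<Rightarrow> nat" where
  "divisor_nth b i = sorted_list_of_set {d. d dvd b} ! (i - 1)"

definition c_const :: "nat \<Rightarrow> real" where
  "c_const b =
     ln (fact (divisor_count b)) / real b +
     (\<Sum>i = 1..divisor_count b - 1.
        (1 / real (divisor_nth b i) - 1 / real (divisor_nth b (i + 1))) *
        ln (real (num_perms (divisor_nth b i) b)))"

(* The multiplicative function with prescribed values at prime powers, written out as a
   product over the prime factorization; the three lemmas below characterize it on b > 0. *)
definition alpha :: "nat \<Rightarrow> real" where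
  "alpha b =
     (\<Prod>p\<in>prime_factors b.
        (real p ^ (multiplicity p b + 1) - real p ^ multiplicity p b) /
        (real p ^ (multiplicity p b + 1) - 1))"

lemma alpha_1: "alpha 1 = 1"
  by (simp add: alpha_def)

lemma alpha_prime_power:
  assumes "prime p" "i > 0"
  shows "alpha (p ^ i) = (real p ^ (i + 1) - real p ^ i) / (real p ^ (i + 1) - 1)"
  using assms
  by (simp add: alpha_def prime_factorization_prime_power)

lemma alpha_mult:
  assumes "coprime m n" "m > 0" "n > 0"
  shows "alpha (m * n) = alpha m * alpha n"
proof -
  define f where
    "f p k = (real p ^ (k + 1) - real p ^ k) / (real p ^ (k + 1) - 1)" for p k :: nat
  have disj: "prime_factors m \<inter> prime_factors n = {}"
    using assms coprime_common_divisor not_prime_unit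
    by (blast dest: in_prime_factors_imp_dvd in_prime_factors_imp_prime)
  have mult: "multiplicity p (m * n) = multiplicity p m + multiplicity p n" if "prime p" for p
    using assms that by (intro prime_elem_multiplicity_mult_distrib) auto
  have zero_n: "multiplicity p n = 0" if "p \<in> prime_factors m" for p
    using that disj assms by (auto simp: prime_factors_multiplicity)
  have zero_m: "multiplicity p m = 0" if "p \<in> prime_factors n" for p
    using that disj assms by (auto simp: prime_factors_multiplicity)
  have "alpha (m * n) = (\<Prod>p\<in>prime_factors m \<union> prime_factors n. f p (multiplicity p (m * n)))"
    using assms by (simp add: alpha_def f_def prime_factors_product)
  also have "\<dots> = (\<Prod>p\<in>prime_factors m. f p (multiplicity p (m * n))) *
                  (\<Prod>p\<in>prime_factors n. f p (multiplicity p (m * n)))"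
    using disj by (intro prod.union_disjoint) auto
  also have "(\<Prod>p\<in>prime_factors m. f p (multiplicity p (m * n))) = alpha m"
    unfolding alpha_def f_def by (intro prod.cong) (simp_all add: mult zero_n in_prime_factors_imp_prime)
  also have "(\<Prod>p\<in>prime_factors n. f p (multiplicity p (m * n))) = alpha n"
    unfolding alpha_def f_def by (intro prod.cong) (simp_all add: mult zero_m in_prime_factors_imp_prime)
  finally show ?thesis .
qed

end

theory Submission
  imports Defs
begin

text \<open>
  Let M be the set of all m such that (v + 1) divides the p-adic valuation of m whenever p is a
  prime factor of b of multiplicity v. Reducing valuations modulo v + 1 shows that every positive
  integer is uniquely of the form d * m with d dividing b and m in M, so [n] is the disjoint union
  of the sets m * s(n div m, b) over the m in M up to n. Permuting each piece separately gives at
  least the product of the numbers p(n div m, b) permutations. Grouping the logarithm of this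
  product by the value of n div m reduces the claim to the fact that M has density alpha b, which
  follows by adding one prime at a time: with q = p ^ (v + 1), the old and new counting functions
  satisfy A' n - A' (n div q) = A n - A (n div p), and this determines the growth of A'.
\<close>

section \<open>Counting functions of sets cut out by valuations\<close>

definition count_upto :: "nat set \<Rightarrow> nat \<Rightarrow> nat" where
  "count_upto A n = card (A \<inter> {1..n})"

text \<open>For arbitrary \<open>P\<close> and \<open>e\<close>, so that primes can be added one at
  a time; later \<open>P\<close> is the set of prime factors of b and \<open>e\<close> gives their
  multiplicities. The condition \<open>m > 0\<close> excludes 0, whose multiplicity is 0 by
  convention and would pass every divisibility test.\<close>

definition core_set :: "nat set \<Rightarrow> (nat \<Rightarrow> nat) \<Rightarrow> nat set" where
  "core_set P e = {m. m > 0 \<and> (\<forall>p\<in>P. Suc (e p) dvd multiplicity p m)}"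

text \<open>The multiples of q in A up to n are exactly q times the elements of B up to
  \<open>n div q\<close>. It is applied with A = B, to sets that are invariant under multiplication
  and division by q.\<close>

lemma count_upto_split:
  assumes q: "q > 0" and AB: "\<And>m. m > 0 \<Longrightarrow> q * m \<in> A \<longleftrightarrow> m \<in> B"
  shows "count_upto A n = count_upto B (n div q) + card {m \<in> A \<inter> {1..n}. \<not> q dvd m}"
proof -
  have "{m \<in> A \<inter> {1..n}. q dvd m} = (*) q ` (B \<inter> {1..n div q})"
  proof (intro equalityI subsetI)
    fix m assume m: "m \<in> {m \<in> A \<inter> {1..n}. q dvd m}"
    then obtain k where k: "m = q * k" by auto
    with m q AB[of k] show "m \<in> (*) q ` (B \<inter> {1..n div q})"
      by (auto simp: less_eq_div_iff_mult_less_eq mult.commute Suc_le_eq)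
  next
    fix m assume "m \<in> (*) q ` (B \<inter> {1..n div q})"
    with q AB show "m \<in> {m \<in> A \<inter> {1..n}. q dvd m}"
      by (auto simp: less_eq_div_iff_mult_less_eq mult.commute Suc_le_eq)
  qed
  moreover have "card ((*) q ` (B \<inter> {1..n div q})) = count_upto B (n div q)"
    unfolding count_upto_def using q by (intro card_image) (auto simp: inj_on_def)
  moreover have "card (A \<inter> {1..n}) =
      card {m \<in> A \<inter> {1..n}. q dvd m} + card {m \<in> A \<inter> {1..n}. \<not> q dvd m}"
    by (subst card_Un_disjoint [symmetric]) (auto intro!: arg_cong[of _ _ card])
  ultimately show ?thesis by (simp add: count_upto_def)
qed

lemma multiplicity_prime_power_times_other:
  fixes p q m :: nat
  assumes "prime p" "prime q" "p \<noteq> q" "m > 0"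
  shows "multiplicity q (p ^ k * m) = multiplicity q m"
  using assms by (simp add: prime_elem_multiplicity_mult_distrib multiplicity_distinct_prime_power)

text \<open>The old set is invariant under scaling by p and the new one under scaling by
  \<open>p ^ Suc (e p)\<close>. Splitting off the multiples of the respective scaling factor leaves
  the same remainder for both, so the two remainders cancel.\<close>

lemma count_core_set_recurrence:
  assumes P: "\<And>q. q \<in> P \<Longrightarrow> prime q" and p: "prime p" "p \<notin> P"
  shows "count_upto (core_set (insert p P) e) n + count_upto (core_set P e) (n div p) =
         count_upto (core_set P e) n + count_upto (core_set (insert p P) e) (n div p ^ Suc (e p))"
proof -
  have p0: "p > 0" using p by (simp add: prime_gt_0_nat)
  have other: "multiplicity q (p ^ k * m) = multiplicity q m" if "q \<in> P" "m > 0" for q k m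
    using multiplicity_prime_power_times_other[of p q m k] P p that by metis
  have self: "multiplicity p (p ^ k * m) = k + multiplicity p m" if "m > 0" for k m
    using that p p0 by (simp add: prime_elem_multiplicity_mult_distrib)
  have 1: "count_upto (core_set (insert p P) e) n =
      count_upto (core_set (insert p P) e) (n div p ^ Suc (e p)) +
      card {m \<in> core_set (insert p P) e \<inter> {1..n}. \<not> p ^ Suc (e p) dvd m}"
  proof (rule count_upto_split)
    fix m :: nat assume m: "m > 0"
    have "Suc (e p) dvd Suc (e p) + multiplicity p m \<longleftrightarrow> Suc (e p) dvd multiplicity p m"
      by (rule dvd_add_right_iff) simp
    then show "p ^ Suc (e p) * m \<in> core_set (insert p P) e \<longleftrightarrow> m \<in> core_set (insert p P) e"
      unfolding core_set_def
      using m p0 other[OF _ m, of _ "Suc (e p)"] self[OF m, of "Suc (e p)"]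
      by (simp del: power_Suc)
  qed (use p0 in simp)
  have 2: "count_upto (core_set P e) n = count_upto (core_set P e) (n div p) +
      card {m \<in> core_set P e \<inter> {1..n}. \<not> p dvd m}"
  proof (rule count_upto_split)
    fix m :: nat assume m: "m > 0"
    then show "p * m \<in> core_set P e \<longleftrightarrow> m \<in> core_set P e"
      unfolding core_set_def using p0 other[OF _ m, of _ 1] by simp
  qed (use p0 in simp)
  \<comment> \<open>In the new set a positive valuation at p is at least \<open>Suc (e p)\<close>,
    and an m not divisible by p meets the condition at p trivially; hence the two remainders
    coincide.\<close>
  have "p ^ Suc (e p) dvd m \<longleftrightarrow> p dvd m"
    if "m > 0" "Suc (e p) dvd multiplicity p m" for m
  proof
    assume "p dvd m"
    then have "multiplicity p m > 0"
      using that p by (simp add: prime_multiplicity_gt_zero_iff)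
    with that have "Suc (e p) \<le> multiplicity p m" by (simp add: dvd_imp_le)
    then show "p ^ Suc (e p) dvd m" by (rule multiplicity_dvd')
  qed (metis dvd_mult_left power_Suc)
  moreover have "Suc (e p) dvd multiplicity p m" if "\<not> p dvd m" for m
    using that by (simp add: not_dvd_imp_multiplicity_0)
  ultimately have "{m \<in> core_set (insert p P) e \<inter> {1..n}. \<not> p ^ Suc (e p) dvd m} =
      {m \<in> core_set P e \<inter> {1..n}. \<not> p dvd m}"
    unfolding core_set_def by blast
  with 1 2 show ?thesis by simp
qed

section \<open>Asymptotics of recurrences in \<open>n div q\<close>, and the density of core
  sets\<close>

lemma tendsto_div_nat:
  fixes f :: "nat \<Rightarrow> real"
  assumes f: "(\<lambda>n. f n / real n) \<longlonglongrightarrow> c" and q: "q > 0"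
  shows "(\<lambda>n. f (n div q) / real n) \<longlonglongrightarrow> c / real q"
proof -
  have lim: "filterlim (\<lambda>n. n div q) at_top at_top"
    unfolding filterlim_at_top
  proof
    fix Z
    show "\<forall>\<^sub>F n in sequentially. Z \<le> n div q"
      using eventually_ge_at_top[of "Z * q"]
      by eventually_elim (use q in \<open>simp add: less_eq_div_iff_mult_less_eq\<close>)
  qed
  have frac: "(\<lambda>n. real (n div q) / real n) \<longlonglongrightarrow> 1 / real q"
  proof (rule real_tendsto_sandwich)
    show "\<forall>\<^sub>F n in sequentially. 1 / real q - 1 / real n \<le> real (n div q) / real n"
      using eventually_gt_at_top[of 0]
    proof eventually_elim
      case (elim n)
      have "n \<le> q * (n div q) + q"
        using q by (metis add_le_mono le_refl less_imp_le mod_less_divisor mult_div_mod_eq)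
      then have "real n \<le> real q * real (n div q) + real q"
        by (metis of_nat_add of_nat_le_iff of_nat_mult)
      then have "(real n - real q) / (real q * real n) \<le> real q * real (n div q) / (real q * real n)"
        by (intro divide_right_mono) auto
      with q elim show ?case by (simp add: diff_divide_distrib)
    qed
    show "\<forall>\<^sub>F n in sequentially. real (n div q) / real n \<le> 1 / real q"
      using eventually_gt_at_top[of 0]
    proof eventually_elim
      case (elim n)
      have "real (n div q) * real q \<le> real n"
        by (metis of_nat_le_iff of_nat_mult div_times_less_eq_dividend)
      with q elim show ?case by (simp add: field_simps)
    qed
    show "(\<lambda>n. 1 / real q - 1 / real n) \<longlonglongrightarrow> 1 / real q"
      using tendsto_diff[OF tendsto_const[of "1 / real q"] lim_1_over_n] by simp
  qed auto
  have "(\<lambda>n. f (n div q) / real (n div q) * (real (n div q) / real n)) \<longlonglongrightarrow> c * (1 / real q)"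
    by (intro tendsto_mult frac filterlim_compose[OF f lim])
  \<comment> \<open>The cancellation needs \<open>n div q > 0\<close>, hence n \<ge> q, because
    division by zero yields 0.\<close>
  moreover have "\<forall>\<^sub>F n in sequentially.
      f (n div q) / real (n div q) * (real (n div q) / real n) = f (n div q) / real n"
    using eventually_ge_at_top[of q]
    by eventually_elim (use q in \<open>simp add: div_greater_zero_iff\<close>)
  ultimately have "(\<lambda>n. f (n div q) / real n) \<longlonglongrightarrow> c * (1 / real q)"
    by (rule Lim_transform_eventually)
  then show ?thesis by simp
qed

text \<open>Iterating n, \<open>n div q\<close>, and so on, the errors \<epsilon> n, \<epsilon> n /
  q, ... form a geometric series bounded by 2 \<epsilon> n since q \<ge> 2. Only the finitely many
  small arguments add a constant.\<close>

lemma tendsto_zero_of_contraction: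
  fixes f :: "nat \<Rightarrow> real"
  assumes q: "q \<ge> 2" and g: "(\<lambda>n. (f n - f (n div q)) / real n) \<longlonglongrightarrow> 0"
  shows "(\<lambda>n. f n / real n) \<longlonglongrightarrow> 0"
proof (rule LIMSEQ_I)
  fix r :: real assume r: "r > 0"
  \<comment> \<open>The final estimate is 3 \<epsilon> n: 2 \<epsilon> n from the geometric series
    and \<epsilon> n to absorb the constant \<open>D\<close>. With r / 4 this stays below r
    n.\<close>
  define \<epsilon> where "\<epsilon> = r / 4"
  have \<epsilon>: "\<epsilon> > 0" using r by (simp add: \<epsilon>_def)
  from LIMSEQ_D[OF g \<epsilon>] obtain N where N: "\<And>n. n \<ge> N \<Longrightarrow> \<bar>(f n - f (n div q)) / real n\<bar> < \<epsilon>"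
    by auto
  \<comment> \<open>\<open>D\<close> dominates f on the initial range, where the limit hypothesis
    gives no information.\<close>
  define D where "D = (\<Sum>n\<le>N. \<bar>f n\<bar>)"
  have bound: "\<bar>f n\<bar> \<le> 2 * \<epsilon> * real n + D" for n
  proof (induction n rule: less_induct)
    case (less n)
    show ?case
    proof (cases "n \<le> N")
      case True
      then have "\<bar>f n\<bar> \<le> D" unfolding D_def by (intro member_le_sum) auto
      then show ?thesis using \<epsilon> by (simp add: add_increasing)
    next
      case False
      then have "\<bar>f n - f (n div q)\<bar> \<le> \<epsilon> * real n"
        using N[of n] by (simp add: abs_divide field_simps)
      moreover have "\<bar>f (n div q)\<bar> \<le> 2 * \<epsilon> * real (n div q) + D"
        using False q by (intro less) auto
      moreover have "2 * real (n div q) \<le> real n"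
      proof -
        have "2 * (n div q) \<le> q * (n div q)" using q by simp
        also have "\<dots> \<le> n" by simp
        finally show ?thesis by linarith
      qed
      then have "\<epsilon> * (2 * real (n div q)) \<le> \<epsilon> * real n"
        using \<epsilon> by (intro mult_left_mono) auto
      ultimately show ?thesis by (simp add: algebra_simps)
    qed
  qed
  obtain K where K: "real K > D / \<epsilon>" using reals_Archimedean2 by blast
  show "\<exists>no. \<forall>n\<ge>no. norm (f n / real n - 0) < r"
  proof (intro exI allI impI)
    fix n assume n: "n \<ge> max 1 K"
    then have "D / \<epsilon> < real n" using K by linarith
    then have "D < \<epsilon> * real n" using \<epsilon> by (simp add: field_simps)
    then have "\<bar>f n\<bar> < 3 * \<epsilon> * real n" using bound[of n] by simp
    also have "\<dots> \<le> r * real n" using r by (intro mult_right_mono) (auto simp: \<epsilon>_def)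
    finally show "norm (f n / real n - 0) < r" using n by (simp add: abs_divide field_simps)
  qed
qed

text \<open>Since (n - n div q) / n tends to 1 - 1/q, subtracting the linear function c n from f
  reduces the claim to the case of limit zero.\<close>

lemma tendsto_of_scaled_difference:
  fixes f :: "nat \<Rightarrow> real"
  assumes q: "q \<ge> 2" and g: "(\<lambda>n. (f n - f (n div q)) / real n) \<longlonglongrightarrow> c * (1 - 1 / real q)"
  shows "(\<lambda>n. f n / real n) \<longlonglongrightarrow> c"
proof -
  have "\<forall>\<^sub>F n in sequentially. real n / real n = (1 :: real)"
    using eventually_gt_at_top[of 0] by eventually_elim simp
  then have one: "(\<lambda>n. real n / real n) \<longlonglongrightarrow> 1" by (simp add: tendsto_eventually)
  have "(\<lambda>n. real (n div q) / real n) \<longlonglongrightarrow> 1 / real q"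
    using tendsto_div_nat[OF one, of q] q by simp
  then have "(\<lambda>n. (f n - f (n div q)) / real n -
      c * (real n / real n - real (n div q) / real n)) \<longlonglongrightarrow> c * (1 - 1 / real q) - c * (1 - 1 / real q)"
    by (intro tendsto_diff tendsto_mult tendsto_const g one)
  also have "(\<lambda>n. (f n - f (n div q)) / real n -
      c * (real n / real n - real (n div q) / real n)) =
    (\<lambda>n. ((f n - c * real n) - (f (n div q) - c * real (n div q))) / real n)"
    by (simp only: diff_divide_distrib right_diff_distrib times_divide_eq_right) (simp add: algebra_simps)
  finally have "(\<lambda>n. ((f n - c * real n) - (f (n div q) - c * real (n div q))) / real n) \<longlonglongrightarrow> 0"
    by simp
  from tendsto_zero_of_contraction[OF q this]
  have "(\<lambda>n. (f n - c * real n) / real n + c * (real n / real n)) \<longlonglongrightarrow> 0 + c * 1"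
    by (intro tendsto_add tendsto_mult tendsto_const one)
  moreover have "\<forall>\<^sub>F n in sequentially.
      (f n - c * real n) / real n + c * (real n / real n) = f n / real n"
    using eventually_gt_at_top[of 0] by eventually_elim (simp add: diff_divide_distrib)
  ultimately have "(\<lambda>n. f n / real n) \<longlonglongrightarrow> 0 + c * 1"
    by (rule Lim_transform_eventually)
  then show ?thesis by simp
qed

text \<open>Induction on the primes: the recurrence turns the density D of the old set into the
  limit D (1 - 1/p) of the scaled differences of the new counting function, and this fixes the new
  density.\<close>

lemma count_core_set_density:
  assumes "finite P" "\<And>q. q \<in> P \<Longrightarrow> prime q"
  shows "(\<lambda>n. real (count_upto (core_set P e) n) / real n) \<longlonglongrightarrow>
    (\<Prod>p\<in>P. (real p ^ (e p + 1) - real p ^ e p) / (real p ^ (e p + 1) - 1))"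
  using assms
proof (induction P)
  case empty
  have "core_set {} e \<inter> {1..n} = {1..n}" for n by (auto simp: core_set_def)
  then have "\<forall>\<^sub>F n in sequentially. real (count_upto (core_set {} e) n) / real n = 1"
    using eventually_gt_at_top[of 0] by (auto elim!: eventually_mono simp: count_upto_def)
  then show ?case by (simp add: tendsto_eventually)
next
  case (insert p P)
  define Q where "Q = p ^ Suc (e p)"
  define D where "D = (\<Prod>p\<in>P. (real p ^ (e p + 1) - real p ^ e p) / (real p ^ (e p + 1) - 1))"
  define A where "A n = real (count_upto (core_set P e) n)" for n
  define B where "B n = real (count_upto (core_set (insert p P) e) n)" for n
  have p: "prime p" "p \<ge> 2" using insert.prems by (auto intro: prime_ge_2_nat)
  have "p ^ 1 \<le> Q" unfolding Q_def using p by (intro power_increasing) auto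
  then have Q: "Q \<ge> 2" using p by simp
  have IH: "(\<lambda>n. A n / real n) \<longlonglongrightarrow> D"
    unfolding A_def D_def using insert by auto
  have "B n - B (n div Q) = A n - A (n div p)" for n
    using count_core_set_recurrence[of P p e n] insert.prems insert.hyps p
    by (simp add: A_def B_def Q_def del: power_Suc)
  moreover have "(\<lambda>n. A n / real n - A (n div p) / real n) \<longlonglongrightarrow> D - D / real p"
    using p by (intro tendsto_diff IH tendsto_div_nat[OF IH]) auto
  ultimately have lim: "(\<lambda>n. (B n - B (n div Q)) / real n) \<longlonglongrightarrow> D - D / real p"
    by (simp add: diff_divide_distrib)
  \<comment> \<open>The new density must solve c (1 - 1/Q) = D (1 - 1/p), and (1 - 1/p) / (1 - 1/Q)
    is the factor of \<open>alpha\<close> at p.\<close>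
  define c where "c = (real p ^ (e p + 1) - real p ^ e p) / (real p ^ (e p + 1) - 1) * D"
  \<comment> \<open>This keeps the denominator of that factor nonzero.\<close>
  have "real p * real p ^ e p > 1" using Q unfolding Q_def
    by (metis Suc_1 Suc_le_lessD of_nat_1 of_nat_less_iff of_nat_power power_Suc)
  then have eq: "D - D / real p = c * (1 - 1 / real Q)"
    using p by (simp add: c_def Q_def divide_simps) (simp add: algebra_simps)
  have "(\<lambda>n. B n / real n) \<longlonglongrightarrow> c"
    using lim unfolding eq by (rule tendsto_of_scaled_difference[OF Q])
  then show ?case using insert.hyps by (simp add: B_def c_def D_def)
qed

section \<open>Unique decomposition of positive integers into a divisor of b and a core\<close>

lemma core_decomposition_exists:
  fixes b j :: nat
  assumes "b > 0" "j > 0"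
  shows "\<exists>d m. d dvd b \<and> m \<in> core_set (prime_factors b) (\<lambda>p. multiplicity p b) \<and> j = d * m"
proof -
  \<comment> \<open>A residue modulo v + 1 is at most v, so \<open>d\<close> divides b; it is also
    at most the valuation of j, so \<open>d\<close> divides j. What remains of the valuation of j is
    a multiple of v + 1.\<close>
  define r where "r p = multiplicity p j mod Suc (multiplicity p b)" for p
  define d where "d = (\<Prod>p\<in>prime_factors b. p ^ r p)"
  have d0: "d > 0" unfolding d_def by (intro prod_pos zero_less_power prime_gt_0_nat) auto
  have mult: "multiplicity p d = (if p \<in> prime_factors b then r p else 0)" if "prime p" for p
    unfolding d_def using that by (intro multiplicity_prod_prime_powers) auto
  have "d dvd b"
  proof (rule multiplicity_le_imp_dvd)
    fix p :: nat assume "prime p"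
    moreover have "r p \<le> multiplicity p b" by (simp add: r_def less_Suc_eq_le[symmetric])
    ultimately show "multiplicity p d \<le> multiplicity p b" by (simp add: mult)
  qed (use d0 in simp)
  moreover have "d dvd j"
    by (rule multiplicity_le_imp_dvd) (use d0 mult in \<open>auto simp: r_def\<close>)
  then obtain m where m: "j = d * m" by auto
  with assms have m0: "m > 0" by simp
  have "Suc (multiplicity p b) dvd multiplicity p m" if p: "p \<in> prime_factors b" for p
  proof -
    have "prime p" using p by auto
    then have "multiplicity p j = r p + multiplicity p m"
      using m d0 m0 p by (simp add: prime_elem_multiplicity_mult_distrib mult)
    then have "multiplicity p m = multiplicity p j - multiplicity p j mod Suc (multiplicity p b)"
      by (simp add: r_def)
    then show ?thesis by (simp add: dvd_minus_mod)
  qed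
  with m0 have "m \<in> core_set (prime_factors b) (\<lambda>p. multiplicity p b)"
    by (simp add: core_set_def)
  ultimately show ?thesis using m by blast
qed

text \<open>At a prime factor of b of multiplicity v, the valuation of d is at most v, hence is the
  residue modulo v + 1 of the valuation of d * m. At all other primes d has valuation 0. So the
  product determines d.\<close>

lemma core_decomposition_unique:
  fixes b :: nat
  defines "M \<equiv> core_set (prime_factors b) (\<lambda>p. multiplicity p b)"
  assumes b: "b > 0" and d: "d dvd b" "d' dvd b" and m: "m \<in> M" "m' \<in> M"
    and eq: "d * m = d' * m'"
  shows "d = d' \<and> m = m'"
proof -
  have pos: "d > 0" "d' > 0" "m > 0" "m' > 0"
    using b d m by (auto simp: M_def core_set_def dvd_pos_nat)
  have "multiplicity p d = multiplicity p d'" if p: "prime p" for p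
  proof (cases "p \<in> prime_factors b")
    case True
    let ?k = "Suc (multiplicity p b)"
    have "multiplicity p (d * m) = multiplicity p d + multiplicity p m"
         "multiplicity p (d' * m') = multiplicity p d' + multiplicity p m'"
      using pos p by (simp_all add: prime_elem_multiplicity_mult_distrib)
    then have sum: "multiplicity p d + multiplicity p m = multiplicity p d' + multiplicity p m'"
      using eq by simp
    have "?k dvd multiplicity p m" "?k dvd multiplicity p m'"
      using m True by (auto simp: M_def core_set_def)
    then obtain x x' where "multiplicity p m = ?k * x" "multiplicity p m' = ?k * x'"
      by (auto simp only: dvd_def)
    with sum have "(multiplicity p d + ?k * x) mod ?k = (multiplicity p d' + ?k * x') mod ?k"
      by simp
    then have "multiplicity p d mod ?k = multiplicity p d' mod ?k"
      by (simp only: mod_mult_self2)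
    moreover have "multiplicity p d < ?k" "multiplicity p d' < ?k"
      using d b by (auto simp: less_Suc_eq_le intro: dvd_imp_multiplicity_le)
    ultimately show ?thesis by (simp only: mod_less)
  next
    case False
    then have "\<not> p dvd b" using b p by (simp add: prime_factors_dvd)
    then have "\<not> p dvd d" "\<not> p dvd d'" using d dvd_trans by blast+
    then show ?thesis by (simp add: not_dvd_imp_multiplicity_0)
  qed
  then have "d = d'" using pos multiplicity_eq_nat by blast
  with eq pos show ?thesis by simp
qed

section \<open>Gluing permutations of the pieces m * s(n div m, b)\<close>

definition cores :: "nat \<Rightarrow> nat set" where
  "cores b = core_set (prime_factors b) (\<lambda>p. multiplicity p b)"

lemma count_cores_density: "(\<lambda>n. real (count_upto (cores b) n) / real n) \<longlonglongrightarrow> alpha b"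
  unfolding cores_def alpha_def by (intro count_core_set_density) auto

text \<open>A family F of admissible permutations, one per core m, is glued to the map d * m -> F m
  d * m on [n]. The lcm scales by m, so it is at most m * (n div m) \<le> n. The family can be read
  off from the glued map, so gluing is injective.\<close>

lemma prod_num_perms_le_card_S_lcm:
  assumes b: "b > 0"
  shows "(\<Prod>m\<in>cores b \<inter> {1..n}. num_perms (n div m) b) \<le> card (S_lcm n)"
proof -
  define I where "I = cores b \<inter> {1..n}"
  define W where "W m = {\<sigma>. \<sigma> permutes small_divisors (n div m) b \<and>
    (\<forall>d\<in>small_divisors (n div m) b. lcm d (\<sigma> d) \<le> n div m)}" for m
  \<comment> \<open>The guard \<open>j > 0\<close> sits inside the existential so that
    \<open>D\<close> and \<open>C\<close> can be chosen as total functions.\<close>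
  have "\<forall>j. \<exists>d m. j > 0 \<longrightarrow> d dvd b \<and> m \<in> cores b \<and> j = d * m"
    using core_decomposition_exists[OF b] unfolding cores_def by blast
  then obtain D C where "\<forall>j. j > 0 \<longrightarrow> D j dvd b \<and> C j \<in> cores b \<and> j = D j * C j"
    by metis
  then have DC: "D j dvd b" "C j \<in> cores b" "D j * C j = j" if "j > 0" for j
    using that by auto
  have core_pos: "m > 0" if "m \<in> cores b" for m
    using that by (simp add: cores_def core_set_def)
  \<comment> \<open>By uniqueness the chosen \<open>D\<close> and \<open>C\<close> are the
    coordinates inverse to (d, m) -> d * m.\<close>
  have uniq: "D (d * m) = d \<and> C (d * m) = m" if "d dvd b" "m \<in> cores b" for d m
  proof -
    have "d * m > 0" using that b core_pos by (auto intro: dvd_pos_nat)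
    with DC[OF this] that core_decomposition_unique[OF b, of "D (d * m)" d "C (d * m)" m]
    show ?thesis by (simp add: cores_def)
  qed
  have C_in: "C j \<in> I" and D_in: "D j \<in> small_divisors (n div C j) b" if j: "j \<in> {1..n}" for j
  proof -
    from j have "j > 0" "j \<le> n" by auto
    note dc = DC[OF this(1)] core_pos[OF DC(2)[OF this(1)]]
    have "D j > 0" using dc b by (auto intro: dvd_pos_nat)
    then have "C j \<le> D j * C j" by simp
    then show "C j \<in> I" using dc \<open>j \<le> n\<close> by (simp add: I_def Suc_le_eq)
    show "D j \<in> small_divisors (n div C j) b"
      using dc \<open>j \<le> n\<close> by (simp add: small_divisors_def less_eq_div_iff_mult_less_eq)
  qed
  \<comment> \<open>Outside [n] the map is the identity, as \<open>permutes\<close>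
    requires.\<close>
  define \<Phi> where "\<Phi> F j = (if j \<in> {1..n} then F (C j) (D j) * C j else j)" for F j
  have W_perm: "F m permutes small_divisors (n div m) b" if "F \<in> PiE I W" "m \<in> I" for F m
    using PiE_mem[OF that] by (simp add: W_def)
  have \<Phi>_mem: "\<Phi> F \<in> S_lcm n" if F: "F \<in> PiE I W" for F
  proof -
    have img: "F (C j) (D j) \<in> small_divisors (n div C j) b" if "j \<in> {1..n}" for j
      using W_perm[OF F C_in[OF that]] D_in[OF that] by (simp add: permutes_in_image)
    \<comment> \<open>The glued map preserves the core and acts on the divisor coordinate
      alone.\<close>
    have DC_\<Phi>: "D (\<Phi> F j) = F (C j) (D j) \<and> C (\<Phi> F j) = C j" if "j \<in> {1..n}" for j
    proof -
      have "F (C j) (D j) dvd b" "C j \<in> cores b"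
        using img[OF that] C_in[OF that] by (auto simp: small_divisors_def I_def)
      from uniq[OF this] that show ?thesis by (simp add: \<Phi>_def)
    qed
    have "\<Phi> F j \<in> {1..n}" if j: "j \<in> {1..n}" for j
    proof -
      have C: "C j > 0" using C_in[OF j] core_pos by (auto simp: I_def)
      have "F (C j) (D j) > 0" "F (C j) (D j) \<le> n div C j"
        using img[OF j] b by (auto simp: small_divisors_def intro: dvd_pos_nat)
      then show ?thesis
        using C j by (simp add: \<Phi>_def less_eq_div_iff_mult_less_eq Suc_le_eq)
    qed
    then have sub: "\<Phi> F ` {1..n} \<subseteq> {1..n}" by blast
    have inj: "inj_on (\<Phi> F) {1..n}"
    proof (rule inj_onI)
      fix i j assume ij: "i \<in> {1..n}" "j \<in> {1..n}" "\<Phi> F i = \<Phi> F j"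
      with DC_\<Phi>[of i] DC_\<Phi>[of j] have C: "C i = C j" and "F (C i) (D i) = F (C j) (D j)"
        by auto
      then have "D i = D j"
        using permutes_inj[OF W_perm[OF F C_in[OF ij(1)]]] by (auto dest: injD)
      then have "D i * C i = D j * C j" using C by simp
      then show "i = j" using DC(3)[of i] DC(3)[of j] ij by simp
    qed
    have "\<Phi> F permutes {1..n}"
    proof (rule bij_imp_permutes)
      show "bij_betw (\<Phi> F) {1..n} {1..n}"
        using inj endo_inj_surj[OF _ sub inj] by (simp add: bij_betw_def)
    qed (simp only: \<Phi>_def if_False)
    moreover have "lcm j (\<Phi> F j) \<le> n" if j: "j \<in> {1..n}" for j
    proof -
      have "F (C j) \<in> W (C j)" using F C_in[OF j] by (rule PiE_mem)
      then have "lcm (D j) (F (C j) (D j)) \<le> n div C j"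
        using D_in[OF j] by (simp add: W_def)
      then have "C j * lcm (D j) (F (C j) (D j)) \<le> C j * (n div C j)" by simp
      also have "\<dots> \<le> n" by simp
      finally have "lcm (F (C j) (D j)) (D j) * C j \<le> n"
        by (simp only: lcm.commute mult.commute)
      then have "lcm (D j * C j) (F (C j) (D j) * C j) \<le> n"
        by (simp only: lcm_mult_right normalize_nat_def id_apply)
      then show ?thesis using j DC(3)[of j] by (simp add: \<Phi>_def)
    qed
    ultimately show ?thesis by (simp add: S_lcm_def)
  qed
  have \<Phi>_inj: "inj_on \<Phi> (PiE I W)"
  proof (rule inj_onI)
    fix F G assume FG: "F \<in> PiE I W" "G \<in> PiE I W" "\<Phi> F = \<Phi> G"
    show "F = G"
    proof (rule PiE_ext[OF FG(1,2)])
      fix m assume m: "m \<in> I"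
      show "F m = G m"
      proof
        fix d
        show "F m d = G m d"
        \<comment> \<open>On the small divisors the value is recovered from the glued map at d * m;
          elsewhere both permutations are the identity.\<close>
        proof (cases "d \<in> small_divisors (n div m) b")
          case True
          have m': "m \<in> cores b" "m > 0" using m core_pos by (auto simp: I_def)
          have d: "d dvd b" "d > 0" using True b by (auto simp: small_divisors_def intro: dvd_pos_nat)
          have "d * m \<in> {1..n}"
            using True m' d by (simp add: small_divisors_def less_eq_div_iff_mult_less_eq Suc_le_eq)
          then have "F m d * m = G m d * m"
            using fun_cong[OF FG(3), of "d * m"] uniq[OF d(1) m'(1)] by (simp add: \<Phi>_def)
          then show ?thesis using m' by simp
        next
          case False
          then show ?thesis using W_perm[OF FG(1) m] W_perm[OF FG(2) m]
            by (simp add: permutes_not_in)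
        qed
      qed
    qed
  qed
  have "finite (S_lcm n)"
    by (rule finite_subset[OF _ finite_permutations[of "{1..n}"]]) (auto simp: S_lcm_def)
  then have "card (PiE I W) \<le> card (S_lcm n)"
    using \<Phi>_inj \<Phi>_mem by (intro card_inj_on_le[of \<Phi>]) auto
  moreover have "card (PiE I W) = (\<Prod>m\<in>I. card (W m))"
    by (rule card_PiE) (simp add: I_def)
  ultimately show ?thesis by (simp add: I_def W_def num_perms_def)
qed

section \<open>Sums over the quotients n div m\<close>

lemma count_upto_div:
  assumes "x > 0"
  shows "count_upto A (n div x) = card {m \<in> A \<inter> {1..n}. x \<le> n div m}"
proof -
  have "m \<le> n div x \<longleftrightarrow> m \<le> n \<and> x \<le> n div m" if "m > 0" for m
  proof -
    \<comment> \<open>Both sides say m * x \<le> n.\<close>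
    have "m \<le> n div x \<longleftrightarrow> x \<le> n div m"
      using assms that by (simp add: less_eq_div_iff_mult_less_eq mult.commute)
    moreover have "n div x \<le> n" by simp
    ultimately show ?thesis by (meson le_trans)
  qed
  then have "A \<inter> {1..n div x} = {m \<in> A \<inter> {1..n}. x \<le> n div m}" by auto
  then show ?thesis by (simp add: count_upto_def)
qed

text \<open>Group by x = n div m: the elements with quotient exactly x are those up to
  \<open>n div x\<close> but beyond \<open>n div Suc x\<close>.\<close>

lemma sum_over_quotients_less:
  fixes L :: "nat \<Rightarrow> real"
  assumes "b > 0"
  shows "(\<Sum>m\<in>{m \<in> A \<inter> {1..n}. n div m < b}. L (n div m)) =
    (\<Sum>x=1..<b. L x * (real (count_upto A (n div x)) - real (count_upto A (n div Suc x))))"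
  using assms
proof (induction b rule: nat_induct_non_zero)
  case 1
  have "{m \<in> A \<inter> {1..n}. n div m < 1} = {}" by (auto simp: div_eq_0_iff)
  then show ?case by simp
next
  case (Suc b)
  let ?S = "\<lambda>P. {m \<in> A \<inter> {1..n}. P (n div m)}"
  have "?S (\<lambda>k. k < Suc b) = ?S (\<lambda>k. k < b) \<union> ?S (\<lambda>k. k = b)" by auto
  then have "(\<Sum>m\<in>?S (\<lambda>k. k < Suc b). L (n div m)) =
      (\<Sum>m\<in>?S (\<lambda>k. k < b). L (n div m)) + (\<Sum>m\<in>?S (\<lambda>k. k = b). L (n div m))"
    by (simp only:) (rule sum.union_disjoint, auto)
  also have "(\<Sum>m\<in>?S (\<lambda>k. k = b). L (n div m)) = L b * real (card (?S (\<lambda>k. k = b)))"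
    by (subst sum.cong[OF refl, of _ _ "\<lambda>_. L b"]) auto
  also have "card (?S (\<lambda>k. b \<le> k)) = card (?S (\<lambda>k. k = b)) + card (?S (\<lambda>k. Suc b \<le> k))"
    by (subst card_Un_disjoint [symmetric]) (auto intro!: arg_cong[of _ _ card])
  then have "real (card (?S (\<lambda>k. k = b))) =
      real (count_upto A (n div b)) - real (count_upto A (n div Suc b))"
    using Suc by (simp add: count_upto_div)
  finally show ?case using Suc by simp
qed

text \<open>As L is constant from b on, all m with n div m \<ge> b contribute one term. This leaves
  a number of terms independent of n, and the limit is taken in each separately.\<close>

lemma sum_over_quotients_limit:
  fixes L :: "nat \<Rightarrow> real"
  assumes b: "b > 0" and L: "\<And>x. x \<ge> b \<Longrightarrow> L x = L b"
    and A: "(\<lambda>n. real (count_upto A n) / real n) \<longlonglongrightarrow> \<delta>"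
  shows "(\<lambda>n. (\<Sum>m\<in>A \<inter> {1..n}. L (n div m)) / real n) \<longlonglongrightarrow>
    (L b / real b + (\<Sum>x=1..<b. (1 / real x - 1 / real (Suc x)) * L x)) * \<delta>"
proof -
  let ?N = "\<lambda>n x. real (count_upto A (n div x))"
  have split: "(\<Sum>m\<in>A \<inter> {1..n}. L (n div m)) =
      L b * ?N n b + (\<Sum>x=1..<b. L x * (?N n x - ?N n (Suc x)))" for n
  proof -
    have "A \<inter> {1..n} = {m \<in> A \<inter> {1..n}. b \<le> n div m} \<union> {m \<in> A \<inter> {1..n}. n div m < b}"
      by auto
    then have "(\<Sum>m\<in>A \<inter> {1..n}. L (n div m)) =
        (\<Sum>m\<in>{m \<in> A \<inter> {1..n}. b \<le> n div m} \<union> {m \<in> A \<inter> {1..n}. n div m < b}. L (n div m))"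
      by (rule arg_cong)
    also have "\<dots> = (\<Sum>m\<in>{m \<in> A \<inter> {1..n}. b \<le> n div m}. L (n div m)) +
        (\<Sum>m\<in>{m \<in> A \<inter> {1..n}. n div m < b}. L (n div m))"
      by (rule sum.union_disjoint) auto
    also have "(\<Sum>m\<in>{m \<in> A \<inter> {1..n}. b \<le> n div m}. L (n div m)) =
        (\<Sum>m\<in>{m \<in> A \<inter> {1..n}. b \<le> n div m}. L b)"
      by (intro sum.cong refl L) auto
    also have "\<dots> = L b * ?N n b"
      by (simp add: count_upto_div[OF b])
    finally show ?thesis by (simp only: sum_over_quotients_less[OF b])
  qed
  have lim: "(\<lambda>n. ?N n x / real n) \<longlonglongrightarrow> \<delta> / real x" if "x > 0" for x
    using tendsto_div_nat[OF A that] .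
  have "(\<lambda>n. L b * (?N n b / real n) +
      (\<Sum>x=1..<b. L x * (?N n x / real n - ?N n (Suc x) / real n))) \<longlonglongrightarrow>
      L b * (\<delta> / real b) + (\<Sum>x=1..<b. L x * (\<delta> / real x - \<delta> / real (Suc x)))"
    using b by (intro tendsto_add tendsto_mult tendsto_const tendsto_sum tendsto_diff lim) auto
  moreover have "(\<Sum>m\<in>A \<inter> {1..n}. L (n div m)) / real n = L b * (?N n b / real n) +
      (\<Sum>x=1..<b. L x * (?N n x / real n - ?N n (Suc x) / real n))" for n
    unfolding split
    by (simp add: add_divide_distrib sum_divide_distrib flip: diff_divide_distrib)
  moreover have "L b * (\<delta> / real b) + (\<Sum>x=1..<b. L x * (\<delta> / real x - \<delta> / real (Suc x))) =
      (L b / real b + (\<Sum>x=1..<b. (1 / real x - 1 / real (Suc x)) * L x)) * \<delta>"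
    by (simp only: distrib_right sum_distrib_right)
      (simp add: diff_divide_distrib algebra_simps del: of_nat_Suc)
  ultimately show ?thesis by simp
qed

section \<open>Values of \<open>num_perms\<close> and the constant \<open>c_const\<close>\<close>

lemma num_perms_cong:
  assumes "a \<le> x" "\<And>d. d dvd b \<Longrightarrow> d \<le> x \<Longrightarrow> d \<le> a"
  shows "num_perms x b = num_perms a b"
proof -
  have iff: "d \<le> x \<longleftrightarrow> d \<le> a" if "d dvd b" for d
    using assms that le_trans by blast
  then have S: "small_divisors x b = small_divisors a b"
    by (auto simp: small_divisors_def)
  have "lcm d (\<sigma> d) \<le> x \<longleftrightarrow> lcm d (\<sigma> d) \<le> a"
    if "\<sigma> permutes small_divisors a b" "d \<in> small_divisors a b" for \<sigma> d
  proof -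
    have "\<sigma> d \<in> small_divisors a b" using that by (simp add: permutes_in_image)
    \<comment> \<open>The lcm of two divisors of b again divides b, so \<open>iff\<close> applies to
      it.\<close>
    then show ?thesis using that by (intro iff lcm_least) (auto simp: small_divisors_def)
  qed
  then show ?thesis unfolding num_perms_def S by (auto intro!: arg_cong[of _ _ card])
qed

text \<open>The identity is always admissible. Positivity lets exp undo the logarithms in the final
  product.\<close>

lemma num_perms_pos: "num_perms a b > 0"
proof -
  have "finite (small_divisors a b)" by (simp add: small_divisors_def)
  then have "finite {\<sigma>. \<sigma> permutes small_divisors a b \<and>
      (\<forall>d\<in>small_divisors a b. lcm d (\<sigma> d) \<le> a)}"
    by (rule finite_subset[rotated, OF finite_permutations]) auto
  moreover have "id \<in> {\<sigma>. \<sigma> permutes small_divisors a b \<and>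
      (\<forall>d\<in>small_divisors a b. lcm d (\<sigma> d) \<le> a)}"
    by (auto simp: permutes_id small_divisors_def)
  ultimately show ?thesis unfolding num_perms_def card_gt_0_iff by blast
qed

lemma num_perms_self:
  assumes "b > 0"
  shows "num_perms b b = fact (divisor_count b)"
proof -
  have S: "small_divisors b b = {d. d dvd b}"
    using assms by (auto simp: small_divisors_def intro: dvd_imp_le)
  have "lcm d (\<sigma> d) \<le> b" if "\<sigma> permutes {d. d dvd b}" "d dvd b" for \<sigma> d
  proof -
    have "\<sigma> d dvd b" using permutes_in_image[OF that(1), of d] that by simp
    then show ?thesis using that assms by (intro dvd_imp_le) auto
  qed
  then have "num_perms b b = card {\<sigma>. \<sigma> permutes {d. d dvd b}}"
    unfolding num_perms_def S by (auto intro!: arg_cong[of _ _ card])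
  also have "\<dots> = fact (divisor_count b)"
    using assms by (intro card_permutations) (auto simp: divisor_count_def)
  finally show ?thesis .
qed

text \<open>Between consecutive divisors of b the value of \<open>num_perms\<close> does not change,
  and the weights 1/x - 1/(x+1) telescope. So the sum over divisors equals the sum over all x below
  b that the density argument produces.\<close>

lemma c_const_eq_sum:
  assumes b: "b > 0"
  shows "c_const b = ln (real (num_perms b b)) / real b +
    (\<Sum>x=1..<b. (1 / real x - 1 / real (Suc x)) * ln (real (num_perms x b)))"
proof -
  define xs where "xs = sorted_list_of_set {d. d dvd b}"
  define L where "L x = ln (real (num_perms x b))" for x
  have fin: "finite {d. d dvd b}" using b by simp
  then have set_xs: "set xs = {d. d dvd b}" and len: "length xs = divisor_count b"
    by (auto simp: xs_def divisor_count_def)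
  have strict: "sorted_wrt (<) xs" by (simp add: xs_def)
  have less: "xs ! i < xs ! j" if "i < j" "j < length xs" for i j
    using sorted_wrt_nth_less[OF strict] that by simp
  have mono: "xs ! i \<le> xs ! j" if "i \<le> j" "j < length xs" for i j
    using less[of i j] that by (cases "i = j") auto
  have pos: "xs ! i > 0" if "i < length xs" for i
    using nth_mem[OF that] b by (auto simp: set_xs intro: dvd_pos_nat)
  have index: "\<exists>i<length xs. xs ! i = d" if "d dvd b" for d
    using that set_xs by (metis in_set_conv_nth mem_Collect_eq)
  from index[of 1] have nonempty: "length xs > 0" by auto
  have first: "xs ! 0 = 1"
  proof -
    obtain i where "i < length xs" "xs ! i = 1" using index[of 1] by auto
    then show ?thesis using mono[of 0 i] pos[OF nonempty] by simp
  qed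
  have last: "xs ! (length xs - 1) = b"
  proof -
    obtain i where i: "i < length xs" "xs ! i = b" using index[of b] by auto
    then have "b \<le> xs ! (length xs - 1)" using mono[of i "length xs - 1"] by simp
    moreover have "xs ! (length xs - 1) dvd b"
      using nth_mem[of "length xs - 1" xs] nonempty by (simp add: set_xs)
    ultimately show ?thesis using b dvd_imp_le by (simp add: antisym)
  qed
  have L_const: "L x = L (xs ! i)" if i: "Suc i < length xs" and x: "xs ! i \<le> x" "x < xs ! Suc i" for i x
  proof -
    have "num_perms x b = num_perms (xs ! i) b"
    proof (rule num_perms_cong[OF x(1)])
      fix d assume d: "d dvd b" "d \<le> x"
      then obtain k where k: "k < length xs" "xs ! k = d" using index by blast
      with d x have "\<not> Suc i \<le> k" using mono[of "Suc i" k] by auto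
      then show "d \<le> xs ! i" using k i mono[of k i] by simp
    qed
    then show ?thesis by (simp add: L_def)
  qed
  have tele: "(\<Sum>x=u..<v. 1 / real x - 1 / real (Suc x)) = 1 / real u - 1 / real v" if "u \<le> v" for u v
    using sum_Suc_diff'[OF that, of "\<lambda>x. - 1 / real x"] by simp
  have "(\<Sum>x=1..<xs!k. (1 / real x - 1 / real (Suc x)) * L x) =
      (\<Sum>i<k. (1 / real (xs ! i) - 1 / real (xs ! Suc i)) * L (xs ! i))" if "k < length xs" for k
    using that
  proof (induction k)
    case 0
    then show ?case by (simp add: first)
  next
    case (Suc k)
    have le: "xs ! k \<le> xs ! Suc k" using Suc.prems by (intro mono) auto
    have "1 \<le> xs ! k" using pos[of k] Suc.prems by simp
    then have "(\<Sum>x=1..<xs ! Suc k. (1 / real x - 1 / real (Suc x)) * L x) =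
        (\<Sum>x=1..<xs ! k. (1 / real x - 1 / real (Suc x)) * L x) +
        (\<Sum>x=xs ! k..<xs ! Suc k. (1 / real x - 1 / real (Suc x)) * L x)"
      using le by (simp only: sum.atLeastLessThan_concat)
    also have "(\<Sum>x=xs ! k..<xs ! Suc k. (1 / real x - 1 / real (Suc x)) * L x) =
        (\<Sum>x=xs ! k..<xs ! Suc k. (1 / real x - 1 / real (Suc x)) * L (xs ! k))"
    proof (rule sum.cong[OF refl])
      fix x assume "x \<in> {xs ! k..<xs ! Suc k}"
      then have "L x = L (xs ! k)" using L_const[OF Suc.prems, of x] by simp
      then show "(1 / real x - 1 / real (Suc x)) * L x = (1 / real x - 1 / real (Suc x)) * L (xs ! k)"
        by simp
    qed
    also have "\<dots> = (1 / real (xs ! k) - 1 / real (xs ! Suc k)) * L (xs ! k)"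
      by (simp only: sum_distrib_right[symmetric] tele[OF le])
    finally show ?case using Suc by simp
  qed
  from this[of "length xs - 1"] nonempty
  have "(\<Sum>x=1..<b. (1 / real x - 1 / real (Suc x)) * L x) =
      (\<Sum>i<length xs - 1. (1 / real (xs ! i) - 1 / real (xs ! Suc i)) * L (xs ! i))"
    by (simp add: last del: One_nat_def)
  \<comment> \<open>The list \<open>xs\<close> is indexed from 0, \<open>divisor_nth\<close> from
    1.\<close>
  also have "\<dots> = (\<Sum>i = 1..divisor_count b - 1.
      (1 / real (divisor_nth b i) - 1 / real (divisor_nth b (i + 1))) * L (divisor_nth b i))"
    by (simp add: sum.atLeast1_atMost_eq len divisor_nth_def flip: xs_def)
  finally show ?thesis
    by (simp add: c_const_def L_def num_perms_self[OF b])
qed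

section \<open>Assembly of the exponential lower bound\<close>

theorem theorem3:
  fixes b :: nat
  assumes "b > 0"
  shows "\<exists>\<epsilon> :: nat \<Rightarrow> real. \<epsilon> \<in> o(\<lambda>_. 1) \<and>
    (\<forall>\<^sub>F n in at_top.
       real (card (S_lcm n)) \<ge> exp ((c_const b * alpha b + \<epsilon> n) * real n))"
proof -
  define L where "L x = ln (real (num_perms x b))" for x
  define T where "T n = (\<Sum>m\<in>cores b \<inter> {1..n}. L (n div m))" for n
  \<comment> \<open>With this choice the exponent is exactly \<open>T n\<close>, the logarithm of
    the product of the local counts; all asymptotics lie in \<epsilon> tending to 0.\<close>
  define \<epsilon> where "\<epsilon> n = T n / real n - c_const b * alpha b" for n
  have "L x = L b" if "x \<ge> b" for x
    using num_perms_cong[OF that, of b] assms by (simp add: L_def dvd_imp_le)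
  from sum_over_quotients_limit[where L = L, OF assms this count_cores_density]
  have "(\<lambda>n. T n / real n) \<longlonglongrightarrow> c_const b * alpha b"
    by (simp only: T_def c_const_eq_sum[OF assms] L_def)
  then have "\<epsilon> \<longlonglongrightarrow> 0"
    unfolding \<epsilon>_def by (simp add: LIM_zero)
  then have "\<epsilon> \<in> o(\<lambda>_. 1)"
    by (intro smalloI_tendsto) auto
  moreover have "\<forall>\<^sub>F n in at_top.
      real (card (S_lcm n)) \<ge> exp ((c_const b * alpha b + \<epsilon> n) * real n)"
    using eventually_gt_at_top[of 0]
  proof eventually_elim
    case (elim n)
    have "exp ((c_const b * alpha b + \<epsilon> n) * real n) = exp (T n)"
      using elim by (simp add: \<epsilon>_def)
    also have "\<dots> = (\<Prod>m\<in>cores b \<inter> {1..n}. real (num_perms (n div m) b))"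
      using num_perms_pos by (simp add: T_def L_def exp_sum)
    also have "\<dots> = real (\<Prod>m\<in>cores b \<inter> {1..n}. num_perms (n div m) b)"
      by simp
    also have "\<dots> \<le> real (card (S_lcm n))"
      using prod_num_perms_le_card_S_lcm[OF assms] by (simp only: of_nat_le_iff)
    finally show ?case .
  qed
  ultimately show ?thesis by blast
qed

end
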